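(* Let the norm on $E$ be $\|\cdot\|=\|\cdot\|_e$, the norm induced by $(K,e)$. Then for any linear subspace $L\subseteq E$ $$\nu(L)=\min_{u\in\Delta(K^*,e)}\ \max_{x\in L,\ \|x\|\le 1}\langle x,u\rangle=\max_{x\in L,\ \|x\|\le 1}\ \min_{u\in\Delta(K^*,e)}\langle x,u\rangle=\max_{x\in L,\ \|x\|\le 1}\lambda_e(x).$$
   Context: $E\neq\{0\}$ is a finite-dimensional real inner product space with inner product $\langle\cdot,\cdot\rangle$. $K\subseteq E$ is a regular closed convex cone ($\operatorname{int}(K)\neq\emptyset$ and $K$ contains no lines), with dual cone $K^*:=\{u\in E:\langle u,x\rangle\ge 0\ \forall x\in K\}$, and $e\in\operatorname{int}(K)$ is fixed. The norm induced by $(K,e)$ is $$\|x\|_e:=\min\{\alpha\ge 0: x+\alpha e\in K,\ -x+\alpha e\in K\}.$$ For a norm $\|\cdot\|$ on $E$, the dual norm is $\|u\|^*:=\max_{\|x\|=1}\langle u,x\rangle$. The eigenvalue mapping induced by $(K,e)$ is $\lambda_e(x):=\max\{t\in\mathbb R: x-te\in K\}$, and $$\Delta(K^*,e):=\{u\in K^*:\|u\|_e^*=1\}=\{u\in K^*:\langle u,e\rangle=1\}.$$ For a linear subspace $L\subseteq E$ with orthogonal complement $L^\perp$, $$\nu(L):=\min_{u\in K^*,\,y\in L^\perp,\,\|u\|^*=1}\|u-y\|^*.$$ *)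

theory Defs
  imports "HOL-Analysis.Analysis"
begin

definition contains_line :: "'a::real_vector set \<Rightarrow> bool" where
  "contains_line K \<longleftrightarrow> (\<exists>a d. d \<noteq> 0 \<and> (\<forall>t::real. a + t *\<^sub>R d \<in> K))"

definition regular_cone :: "'a::euclidean_space set \<Rightarrow> bool" where
  "regular_cone K \<longleftrightarrow> closed K \<and> convex_cone K \<and> interior K \<noteq> {} \<and> \<not> contains_line K"

definition dual_cone :: "'a::real_inner set \<Rightarrow> 'a set" where
  "dual_cone K = {u. \<forall>x\<in>K. 0 \<le> u \<bullet> x}"

(* Minima and maxima are rendered by Inf and Sup. For cone_norm, dual_norm and cone_eigenvalue
   the lemmas cone_norm_attained, dual_norm_attained and cone_eigenvalue_attained below show
   that these bounds are attained. *)

definition cone_norm :: "'a::euclidean_space set \<Rightarrow> 'a \<Rightarrow> 'a \<Rightarrow> real" where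
  "cone_norm K e x = Inf {\<alpha>. 0 \<le> \<alpha> \<and> x + \<alpha> *\<^sub>R e \<in> K \<and> - x + \<alpha> *\<^sub>R e \<in> K}"

(* N is an arbitrary norm on the space, in general different from the inner product norm. *)
definition dual_norm :: "('a::euclidean_space \<Rightarrow> real) \<Rightarrow> 'a \<Rightarrow> real" where
  "dual_norm N u = (SUP x\<in>{x. N x = 1}. u \<bullet> x)"

definition cone_eigenvalue :: "'a::euclidean_space set \<Rightarrow> 'a \<Rightarrow> 'a \<Rightarrow> real" where
  "cone_eigenvalue K e x = Sup {t. x - t *\<^sub>R e \<in> K}"

definition dual_slice :: "'a::euclidean_space set \<Rightarrow> 'a \<Rightarrow> 'a set" where
  "dual_slice K e = {u \<in> dual_cone K. dual_norm (cone_norm K e) u = 1}"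

definition nu_domain :: "('a::euclidean_space \<Rightarrow> real) \<Rightarrow> 'a set \<Rightarrow> 'a set \<Rightarrow> ('a \<times> 'a) set" where
  "nu_domain N K L = {(u, y). u \<in> dual_cone K \<and> y \<in> L\<^sup>\<bottom> \<and> dual_norm N u = 1}"

definition nu :: "('a::euclidean_space \<Rightarrow> real) \<Rightarrow> 'a set \<Rightarrow> 'a set \<Rightarrow> real" where
  "nu N K L = (INF (u, y)\<in>nu_domain N K L. dual_norm N (u - y))"

definition attains_min :: "('b \<Rightarrow> real) \<Rightarrow> 'b set \<Rightarrow> bool" where
  "attains_min f A \<longleftrightarrow> (\<exists>a\<in>A. \<forall>b\<in>A. f a \<le> f b)"

definition attains_max :: "('b \<Rightarrow> real) \<Rightarrow> 'b set \<Rightarrow> bool" where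
  "attains_max f A \<longleftrightarrow> (\<exists>a\<in>A. \<forall>b\<in>A. f b \<le> f a)"

context
  fixes K :: "'a::euclidean_space set" and e :: 'a
  assumes K: "regular_cone K" and e: "e \<in> interior K"
begin

private lemma closedK: "closed K" and nonempty: "K \<noteq> {}" and
  add: "x \<in> K \<Longrightarrow> y \<in> K \<Longrightarrow> x + y \<in> K" and
  scale: "x \<in> K \<Longrightarrow> 0 \<le> c \<Longrightarrow> c *\<^sub>R x \<in> K"
  using K by (auto simp: regular_cone_def convex_cone_nonempty convex_cone_add convex_cone_scaleR)

private lemma zero: "0 \<in> K"
  using nonempty scale[of _ 0] by auto

private lemma eK: "e \<in> K"
  using e interior_subset by blast

private lemma pointed: assumes "x \<in> K" "- x \<in> K" shows "x = 0"
proof (rule ccontr)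
  assume "x \<noteq> 0"
  moreover have "0 + t *\<^sub>R x \<in> K" for t
    using scale[OF assms(1), of t] scale[OF assms(2), of "- t"] by (cases "0 \<le> t") auto
  ultimately have "contains_line K"
    unfolding contains_line_def by blast
  then show False
    using K by (simp add: regular_cone_def)
qed

private lemma e_absorbing: "\<exists>r>0. \<forall>x. x + (norm x / r) *\<^sub>R e \<in> K"
proof -
  obtain r where r: "r > 0" "cball e r \<subseteq> K"
    using e by (meson mem_interior_cball)
  have "x + (norm x / r) *\<^sub>R e \<in> K" for x
  proof (cases "x = 0")
    case False
    have "e + (r / norm x) *\<^sub>R x \<in> cball e r"
      using r False by (simp add: dist_norm)
    then have "(norm x / r) *\<^sub>R (e + (r / norm x) *\<^sub>R x) \<in> K"
      using r scale by auto
    then show ?thesis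
      using r False by (simp add: scaleR_add_right add.commute)
  qed (simp add: zero)
  then show ?thesis using r by blast
qed

private abbreviation "A x \<equiv> {\<alpha>. 0 \<le> \<alpha> \<and> x + \<alpha> *\<^sub>R e \<in> K \<and> - x + \<alpha> *\<^sub>R e \<in> K}"

private lemma bddA: "bdd_below (A x)"
  by (rule bdd_belowI[of _ 0]) auto

private lemma cone_norm_le: "\<alpha> \<in> A x \<Longrightarrow> cone_norm K e x \<le> \<alpha>"
  unfolding cone_norm_def by (rule cInf_lower[OF _ bddA])

lemma cone_norm_attained:
  "0 \<le> cone_norm K e x \<and> x + cone_norm K e x *\<^sub>R e \<in> K \<and> - x + cone_norm K e x *\<^sub>R e \<in> K"
proof -
  obtain r where r: "r > 0" "\<And>x. x + (norm x / r) *\<^sub>R e \<in> K"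
    using e_absorbing by blast
  have "norm x / r \<in> A x"
    using r(1) r(2)[of x] r(2)[of "- x"] by simp
  then have ne: "A x \<noteq> {}" by blast
  have "A x = {0..} \<inter> ((\<lambda>\<alpha>. x + \<alpha> *\<^sub>R e) -` K \<inter> (\<lambda>\<alpha>. - x + \<alpha> *\<^sub>R e) -` K)"
    by auto
  moreover have "closed \<dots>"
    by (intro closed_Int closed_atLeast closed_vimage closedK continuous_intros)
  ultimately have "closed (A x)" by simp
  from closed_contains_Inf[OF ne bddA this] show ?thesis
    unfolding cone_norm_def by simp
qed

lemma cone_norm_zero_iff: "cone_norm K e x = 0 \<longleftrightarrow> x = 0"
proof
  assume "cone_norm K e x = 0"
  then show "x = 0"
    using cone_norm_attained[of x] pointed by simp
next
  assume "x = 0"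
  then show "cone_norm K e x = 0"
    using cone_norm_le[of 0 x] cone_norm_attained[of x] zero by simp
qed

lemma cone_norm_triangle: "cone_norm K e (x + y) \<le> cone_norm K e x + cone_norm K e y"
proof (rule cone_norm_le)
  show "cone_norm K e x + cone_norm K e y \<in> A (x + y)"
    using cone_norm_attained[of x] cone_norm_attained[of y]
      add[of "x + cone_norm K e x *\<^sub>R e" "y + cone_norm K e y *\<^sub>R e"]
      add[of "- x + cone_norm K e x *\<^sub>R e" "- y + cone_norm K e y *\<^sub>R e"]
    by (simp add: algebra_simps)
qed

private lemma cone_norm_scale_le: "0 \<le> c \<Longrightarrow> cone_norm K e (c *\<^sub>R x) \<le> c * cone_norm K e x"
proof (rule cone_norm_le)
  assume "0 \<le> c"
  then show "c * cone_norm K e x \<in> A (c *\<^sub>R x)"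
    using cone_norm_attained[of x]
      scale[of "x + cone_norm K e x *\<^sub>R e" c] scale[of "- x + cone_norm K e x *\<^sub>R e" c]
    by (simp add: algebra_simps)
qed

private lemma cone_norm_minus: "cone_norm K e (- x) = cone_norm K e x"
proof -
  have "A (- x) = A x" by auto
  then show ?thesis by (simp only: cone_norm_def)
qed

lemma cone_norm_scale: "cone_norm K e (c *\<^sub>R x) = \<bar>c\<bar> * cone_norm K e x"
proof -
  have pos: "cone_norm K e (c *\<^sub>R x) = c * cone_norm K e x" if "0 < c" for c
    using cone_norm_scale_le[of c x] cone_norm_scale_le[of "inverse c" "c *\<^sub>R x"] that
    by (simp add: field_simps)
  consider "c = 0" | "0 < c" | "c < 0" by linarith
  then show ?thesis
  proof cases
    case 1
    then show ?thesis by (simp add: cone_norm_zero_iff)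
  next
    case 2
    then show ?thesis using pos by simp
  next
    case 3
    then show ?thesis
      using pos[of "- c"] cone_norm_minus[of "c *\<^sub>R x"] by simp
  qed
qed

lemma cone_norm_continuous: "continuous_on UNIV (cone_norm K e)"
proof -
  obtain r where r: "r > 0" "\<And>x. x + (norm x / r) *\<^sub>R e \<in> K"
    using e_absorbing by blast
  have le: "cone_norm K e x \<le> norm x / r" for x
    using r(1) r(2)[of x] r(2)[of "- x"] by (intro cone_norm_le) simp
  have one: "cone_norm K e x - cone_norm K e y \<le> norm (x - y) / r" for x y
    using cone_norm_triangle[of "x - y" y] le[of "x - y"] by simp
  have "(1 / r)-lipschitz_on UNIV (cone_norm K e)"
  proof (rule lipschitz_onI)
    fix x y
    show "dist (cone_norm K e x) (cone_norm K e y) \<le> 1 / r * dist x y"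
      using one[of x y] one[of y x] by (simp add: dist_norm norm_minus_commute abs_le_iff)
  qed (use r in simp)
  then show ?thesis by (rule lipschitz_on_continuous_on)
qed

lemma cone_norm_sphere: "compact {x. cone_norm K e x = 1}" "{x. cone_norm K e x = 1} \<noteq> {}"
proof -
  let ?S = "sphere (0::'a) 1"
  have "?S \<noteq> {}" by simp
  then obtain z where z: "z \<in> ?S" "\<And>x. x \<in> ?S \<Longrightarrow> cone_norm K e z \<le> cone_norm K e x"
    using continuous_attains_inf[OF compact_sphere _ continuous_on_subset[OF cone_norm_continuous]]
    by (metis subset_UNIV)
  define c where "c = cone_norm K e z"
  have "z \<noteq> 0" using z by auto
  then have c: "c > 0"
    using cone_norm_attained[of z] cone_norm_zero_iff[of z] unfolding c_def by linarith
  have "norm x \<le> 1 / c" if "cone_norm K e x = 1" for x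
  proof -
    have "x \<noteq> 0" using that cone_norm_zero_iff[of x] by auto
    then have "c \<le> cone_norm K e ((1 / norm x) *\<^sub>R x)"
      unfolding c_def by (intro z(2)) simp
    then show ?thesis
      using that c \<open>x \<noteq> 0\<close> by (simp add: cone_norm_scale field_simps)
  qed
  then have "bounded {x. cone_norm K e x = 1}"
    unfolding bounded_iff by blast
  moreover have "closed {x. cone_norm K e x = 1}"
    using closed_vimage[OF closed_singleton[of 1] cone_norm_continuous] by (simp add: vimage_def)
  ultimately show "compact {x. cone_norm K e x = 1}"
    by (simp add: compact_eq_bounded_closed)
  have "cone_norm K e ((1 / c) *\<^sub>R z) = 1"
    using c by (simp add: cone_norm_scale) (simp add: c_def)
  then show "{x. cone_norm K e x = 1} \<noteq> {}" by blast
qed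

lemma dual_norm_attained:
  "\<exists>x. cone_norm K e x = 1 \<and> dual_norm (cone_norm K e) u = u \<bullet> x \<and>
     (\<forall>y. cone_norm K e y = 1 \<longrightarrow> u \<bullet> y \<le> u \<bullet> x)"
proof -
  let ?S = "{x. cone_norm K e x = 1}"
  have "continuous_on ?S (\<lambda>x. u \<bullet> x)"
    by (intro continuous_intros)
  from continuous_attains_sup[OF cone_norm_sphere this]
  obtain x where x: "x \<in> ?S" "\<And>y. y \<in> ?S \<Longrightarrow> u \<bullet> y \<le> u \<bullet> x"
    by blast
  have "dual_norm (cone_norm K e) u = u \<bullet> x"
    unfolding dual_norm_def using x by (intro cSup_eq_maximum) auto
  then show ?thesis using x by blast
qed

private lemma e0: "e \<noteq> 0"
proof
  assume "e = 0"
  then have "x = 0" for x :: 'a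
    using cone_norm_attained[of x] pointed[of x] by simp
  then show False
    using nonzero_Basis by blast
qed

private lemma cone_norm_e: "cone_norm K e e = 1"
proof (rule antisym)
  show "cone_norm K e e \<le> 1"
    using add[OF eK eK] zero by (intro cone_norm_le) simp
  show "1 \<le> cone_norm K e e"
  proof (rule ccontr)
    assume less: "\<not> 1 \<le> cone_norm K e e"
    have "- ((1 - cone_norm K e e) *\<^sub>R e) \<in> K"
      using cone_norm_attained[of e] by (simp add: algebra_simps)
    then show False
      using pointed[OF scale[OF eK], of "1 - cone_norm K e e"] less e0 by auto
  qed
qed

lemma dual_slice_eq: "dual_slice K e = {u \<in> dual_cone K. u \<bullet> e = 1}"
proof -
  have "dual_norm (cone_norm K e) u = u \<bullet> e" if u: "u \<in> dual_cone K" for u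
  proof -
    have "u \<bullet> y \<le> u \<bullet> e" if "cone_norm K e y = 1" for y
    proof -
      have "- y + e \<in> K"
        using cone_norm_attained[of y] that by simp
      with u have "0 \<le> u \<bullet> (- y + e)"
        unfolding dual_cone_def by blast
      then show ?thesis
        by (simp add: inner_diff_right)
    qed
    then show ?thesis
      unfolding dual_norm_def using cone_norm_e by (intro cSup_eq_maximum) auto
  qed
  then show ?thesis
    unfolding dual_slice_def by auto
qed

lemma cone_eigenvalue_attained:
  "x - cone_eigenvalue K e x *\<^sub>R e \<in> K" "x - t *\<^sub>R e \<in> K \<Longrightarrow> t \<le> cone_eigenvalue K e x"
proof -
  let ?T = "{t. x - t *\<^sub>R e \<in> K}"
  have "- cone_norm K e x \<in> ?T"
    using cone_norm_attained[of x] by simp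
  then have ne: "?T \<noteq> {}" by blast
  have bd: "bdd_above ?T"
  proof (rule bdd_aboveI)
    fix t assume "t \<in> ?T"
    then have "(x - t *\<^sub>R e) + (- x + cone_norm K e x *\<^sub>R e) \<in> K"
      using cone_norm_attained[of x] by (intro add[of "x - t *\<^sub>R e"]) auto
    then have mem: "- ((t - cone_norm K e x) *\<^sub>R e) \<in> K"
      by (simp add: algebra_simps)
    show "t \<le> cone_norm K e x"
    proof (rule ccontr)
      assume "\<not> t \<le> cone_norm K e x"
      then show False
        using pointed[OF scale[OF eK] mem] e0 by simp
    qed
  qed
  have "?T = (\<lambda>t. x - t *\<^sub>R e) -` K" by auto
  moreover have "closed \<dots>"
    by (intro closed_vimage closedK continuous_intros)
  ultimately have "closed ?T" by simp
  from closed_contains_Sup[OF ne bd this]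
  show "x - cone_eigenvalue K e x *\<^sub>R e \<in> K"
    unfolding cone_eigenvalue_def by simp
  show "x - t *\<^sub>R e \<in> K \<Longrightarrow> t \<le> cone_eigenvalue K e x"
    unfolding cone_eigenvalue_def using bd by (intro cSup_upper) auto
qed

end

end

theory Submission
  imports Defs
begin

text \<open>
  Let \<open>v\<close> be the maximum of the eigenvalue mapping over the unit ball of \<open>L\<close>. A supporting
  hyperplane of \<open>K\<close> at \<open>x - \<lambda> e\<close>, where \<open>\<lambda>\<close> is the eigenvalue of \<open>x\<close>, yields a point of the dual
  slice at which \<open>u \<mapsto> \<langle>x, u\<rangle>\<close> attains its minimum \<open>\<lambda>\<close>. Hence each of the four quantities is at
  least \<open>v\<close>, and everything follows once some \<open>u\<close> in the dual slice and some \<open>y\<close> orthogonal to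
  \<open>L\<close> satisfy \<open>\<parallel>u - y\<parallel>\<^sup>* \<le> v\<close>. If there were none, a hyperplane with normal \<open>a\<close> would separate the
  compact set of all \<open>u - w\<close>, \<open>u\<close> in the dual slice and \<open>\<parallel>w\<parallel>\<^sup>* \<le> v\<close>, strictly from the orthogonal complement of \<open>L\<close>.
  Then \<open>a\<close> lies in \<open>L\<close> and its eigenvalue exceeds \<open>v \<parallel>a\<parallel>\<close>, contradicting the choice of \<open>v\<close>.
\<close>

text \<open>A nonzero value at \<open>y\<close> could be scaled to \<open>b + 1\<close> inside
  \<open>W\<close>. This places the normal of a hyperplane separating a set from the orthogonal
  complement of \<open>L\<close> back in \<open>L\<close>.\<close>

lemma subspace_bounded_above_imp_orthogonal_comp:
  fixes a :: "'a::real_inner"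
  assumes "subspace W" and bound: "\<And>y. y \<in> W \<Longrightarrow> a \<bullet> y \<le> b"
  shows "a \<in> W\<^sup>\<bottom>"
  unfolding orthogonal_comp_def orthogonal_def
proof clarify
  fix y assume y: "y \<in> W"
  have "y \<bullet> a = 0"
  proof (rule ccontr)
    assume nz: "y \<bullet> a \<noteq> 0"
    have "a \<bullet> (((b + 1) / (y \<bullet> a)) *\<^sub>R y) \<le> b"
      using assms(1) y by (intro bound subspace_scale)
    then show False
      using nz by (simp add: inner_commute)
  qed
  then show "y \<bullet> a = 0" .
qed

context
  fixes K :: "'a::euclidean_space set" and e :: 'a
  assumes K: "regular_cone K" and e: "e \<in> interior K"
begin

private abbreviation "N \<equiv> cone_norm K e"
private abbreviation "eig \<equiv> cone_eigenvalue K e"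

private lemmas norm_mem = cone_norm_attained[OF K e]
private lemmas norm_eq_0 = cone_norm_zero_iff[OF K e]
private lemmas norm_scale = cone_norm_scale[OF K e]
private lemmas eig_mem = cone_eigenvalue_attained(1)[OF K e]
private lemmas eig_ge = cone_eigenvalue_attained(2)[OF K e]
private lemmas slice_eq = dual_slice_eq[OF K e]

private lemma closedK: "closed K" and convexK: "convex K" and
  add: "x \<in> K \<Longrightarrow> y \<in> K \<Longrightarrow> x + y \<in> K" and
  scale: "x \<in> K \<Longrightarrow> 0 \<le> c \<Longrightarrow> c *\<^sub>R x \<in> K" and
  zeroK: "0 \<in> K"
  using K by (auto simp: regular_cone_def convex_cone_add convex_cone_scaleR convex_cone
      conic_contains_0 convex_cone_def)

section \<open>Comparison of the cone norm with the inner product norm\<close>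

lemma cone_norm_zero: "N 0 = 0"
  by (simp add: norm_eq_0)

lemma cone_norm_minus: "N (- x) = N x"
  using norm_scale[of "-1" x] by simp

lemma cone_norm_le_norm:
  obtains M where "M > 0" "\<And>x. N x \<le> M * norm x"
proof -
  have "compact (N ` sphere 0 1)"
    by (intro compact_continuous_image continuous_on_subset[OF cone_norm_continuous[OF K e]]) auto
  then obtain M where M: "M > 0" "\<And>x. norm x = 1 \<Longrightarrow> N x \<le> M"
    using bounded_pos compact_imp_bounded by (force simp: bounded_pos)
  have "N x \<le> M * norm x" for x
  proof (cases "x = 0")
    case False
    then have "N ((1 / norm x) *\<^sub>R x) \<le> M"
      by (intro M) simp
    then show ?thesis
      using False by (simp add: norm_scale field_simps)
  qed (simp add: cone_norm_zero)
  then show ?thesis using M that by blast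
qed

lemma norm_le_cone_norm:
  obtains C where "C > 0" "\<And>x. norm x \<le> C * N x"
proof -
  obtain C where C: "C > 0" "\<And>x. N x = 1 \<Longrightarrow> norm x \<le> C"
    using compact_imp_bounded[OF cone_norm_sphere(1)[OF K e]] by (auto simp: bounded_pos)
  have "norm x \<le> C * N x" for x
  proof (cases "x = 0")
    case False
    then have pos: "N x > 0"
      using norm_mem[of x] norm_eq_0[of x] by linarith
    then have "norm ((1 / N x) *\<^sub>R x) \<le> C"
      by (intro C) (simp add: norm_scale)
    then show ?thesis
      using pos by (simp add: field_simps)
  qed (simp add: cone_norm_zero)
  then show ?thesis using C that by blast
qed

lemma compact_cone_norm_ball_Int_subspace:
  assumes "subspace L"
  shows "compact {x \<in> L. N x \<le> 1}"
proof -
  have "closed (L \<inter> N -` {..1})"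
    using cone_norm_continuous[OF K e]
    by (intro closed_Int closed_subspace[OF assms] closed_vimage) auto
  then have "closed {x \<in> L. N x \<le> 1}"
    by (simp add: vimage_def Collect_conj_eq)
  moreover obtain C where C: "C > 0" "\<And>x. norm x \<le> C * N x"
    using norm_le_cone_norm by blast
  have "norm x \<le> C" if "N x \<le> 1" for x
    using C(2)[of x] mult_left_le[OF that] C(1) by (smt (verit))
  then have "bounded {x \<in> L. N x \<le> 1}"
    unfolding bounded_iff by blast
  ultimately show ?thesis
    by (simp add: compact_eq_bounded_closed)
qed

section \<open>Pairing bounds for the dual norm\<close>

lemma inner_le_dual_norm: "w \<bullet> x \<le> dual_norm N w * N x"
proof (cases "x = 0")
  case False
  then have pos: "N x > 0"
    using norm_mem[of x] norm_eq_0[of x] by linarith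
  then have "N ((1 / N x) *\<^sub>R x) = 1"
    by (simp add: norm_scale)
  then have "w \<bullet> ((1 / N x) *\<^sub>R x) \<le> dual_norm N w"
    using dual_norm_attained[OF K e, of w] by metis
  then show ?thesis
    using pos by (simp add: field_simps)
qed (simp add: cone_norm_zero)

lemma dual_norm_nonneg: "0 \<le> dual_norm N w"
proof -
  obtain x where x: "N x = 1" "dual_norm N w = w \<bullet> x"
    using dual_norm_attained[OF K e, of w] by blast
  then show ?thesis
    using inner_le_dual_norm[of w "- x"] cone_norm_minus[of x] by simp
qed

lemma dual_norm_leI: "(\<And>x. w \<bullet> x \<le> c * N x) \<Longrightarrow> dual_norm N w \<le> c"
  using dual_norm_attained[OF K e, of w] by (metis mult.right_neutral)

lemma dual_slice_inner_le:
  assumes "u \<in> dual_slice K e"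
  shows "u \<bullet> x \<le> N x"
  using inner_le_dual_norm[of u x] assms by (simp add: dual_slice_def)

section \<open>Eigenvalues as minima over the dual slice\<close>

lemma cone_eigenvalue_le_inner:
  assumes "u \<in> dual_slice K e"
  shows "eig x \<le> x \<bullet> u"
proof -
  have "0 \<le> u \<bullet> (x - eig x *\<^sub>R e)"
    using assms eig_mem[of x] by (simp add: slice_eq dual_cone_def)
  then show ?thesis
    using assms by (simp add: slice_eq inner_diff_right inner_commute)
qed

lemma cone_eigenvalue_eq_inner:
  obtains u where "u \<in> dual_slice K e" "x \<bullet> u = eig x"
proof -
  define z where "z = x - eig x *\<^sub>R e"
  have z: "z \<in> K" using eig_mem by (simp add: z_def)
  \<comment> \<open>From an interior point a further multiple of \<open>e\<close> could be
    subtracted, against the maximality of \<open>eig x\<close>.\<close>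
  have "z \<notin> interior K"
  proof
    assume "z \<in> interior K"
    then obtain r where r: "r > 0" "cball z r \<subseteq> K"
      by (meson mem_interior_cball)
    define s where "s = r / (norm e + 1)"
    have s: "s > 0" "s * norm e \<le> r"
      using r by (auto simp: s_def field_simps add_pos_nonneg)
    then have "z - s *\<^sub>R e \<in> K"
      using r by (auto simp: dist_norm subset_iff)
    then have "x - (eig x + s) *\<^sub>R e \<in> K"
      by (simp add: z_def algebra_simps)
    then show False
      using eig_ge s by fastforce
  qed
  then have "z \<notin> rel_interior K"
    using rel_interior_nonempty_interior[of K] e by fastforce
  moreover have "z \<in> closure K"
    using z closure_subset by blast
  ultimately obtain a where a: "a \<noteq> 0" "\<And>y. y \<in> closure K \<Longrightarrow> a \<bullet> z \<le> a \<bullet> y"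
    using supporting_hyperplane_relative_frontier[OF convexK] by metis
  \<comment> \<open>\<open>a\<close> is minimal over \<open>K\<close> at \<open>z\<close>, and
    \<open>K\<close> contains both \<open>0\<close> and \<open>2 *\<^sub>R z\<close>.\<close>
  have az: "a \<bullet> z = 0"
    using a(2)[of 0] a(2)[of "2 *\<^sub>R z"] zeroK scale[OF z, of 2] closedK by simp
  then have aK: "0 \<le> a \<bullet> y" if "y \<in> K" for y
    using a(2)[of y] that az closedK by simp
  obtain r where r: "r > 0" "cball e r \<subseteq> K"
    using e by (meson mem_interior_cball)
  \<comment> \<open>Moving from \<open>e\<close> against \<open>a\<close> stays in \<open>K\<close>,
    which makes \<open>a \<bullet> e\<close> strictly positive and allows the normalization
    below.\<close>
  have "e - (r / norm a) *\<^sub>R a \<in> K"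
    using r a by (auto simp: dist_norm subset_iff)
  then have "r / norm a * (a \<bullet> a) \<le> a \<bullet> e"
    using aK[of "e - (r / norm a) *\<^sub>R a"] by (simp add: inner_diff_right)
  moreover have "0 < r / norm a * (a \<bullet> a)"
    using r a by simp
  ultimately have ae: "a \<bullet> e > 0" by linarith
  define u where "u = (1 / (a \<bullet> e)) *\<^sub>R a"
  have u: "u \<in> dual_slice K e"
    using ae aK by (auto simp: slice_eq dual_cone_def u_def)
  have "u \<bullet> z = 0"
    using az by (simp add: u_def)
  then have "x \<bullet> u = eig x"
    using u by (simp add: z_def slice_eq inner_diff_right inner_commute)
  with u show ?thesis using that by blast
qed

text \<open>\<open>N a\<close> is the larger of \<open>- eig a\<close> and
  \<open>- eig (- a)\<close>, so a norming functional comes from the slice: minus a minimizer for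
  \<open>a\<close>, or a minimizer for \<open>- a\<close>.\<close>

lemma cone_norm_eq_inner:
  obtains w where "\<And>x. w \<bullet> x \<le> N x" "w \<bullet> a = N a"
proof -
  obtain u1 where u1: "u1 \<in> dual_slice K e" "a \<bullet> u1 = eig a"
    using cone_eigenvalue_eq_inner by blast
  obtain u2 where u2: "u2 \<in> dual_slice K e" "- a \<bullet> u2 = eig (- a)"
    using cone_eigenvalue_eq_inner by blast
  define m where "m = max (- eig a) (- eig (- a))"
  have b1: "- u1 \<bullet> x \<le> N x" and b2: "u2 \<bullet> x \<le> N x" for x
    using dual_slice_inner_le[OF u1(1), of "- x"] dual_slice_inner_le[OF u2(1), of x]
    by (simp_all add: cone_norm_minus)
  have mono: "x + m *\<^sub>R e \<in> K" if "- eig x \<le> m" for x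
    using add[OF eig_mem[of x] scale[of e "m + eig x"]] e interior_subset[of K] that
    by (auto simp: algebra_simps)
  have "a + m *\<^sub>R e \<in> K" "- a + m *\<^sub>R e \<in> K"
    by (intro mono; simp add: m_def)+
  \<comment> \<open>Evaluating \<open>a\<close> at \<open>u2\<close> gives
    \<open>eig a \<le> - eig (- a)\<close>, so the two entries of the maximum cannot both be
    negative.\<close>
  moreover have "0 \<le> m"
  proof -
    have "a \<bullet> u2 = - eig (- a)" using u2 by simp
    then show ?thesis
      using cone_eigenvalue_le_inner[OF u2(1), of a] by (simp add: m_def)
  qed
  ultimately have "N a \<le> m"
    unfolding cone_norm_def by (intro cInf_lower bdd_belowI[of _ 0]) auto
  then consider "N a \<le> - u1 \<bullet> a" | "N a \<le> u2 \<bullet> a"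
    using u1 u2 unfolding m_def by (fastforce simp: inner_commute)
  then show ?thesis
    using that[of "- u1"] that[of u2] b1 b2 by cases (auto intro: antisym)
qed

section \<open>Continuity, compactness and convexity\<close>

lemma continuous_on_cone_eigenvalue: "continuous_on S eig"
proof -
  obtain M where M: "M > 0" "\<And>x. N x \<le> M * norm x"
    using cone_norm_le_norm by blast
  have one: "eig x - eig y \<le> M * norm (x - y)" for x y
  proof -
    \<comment> \<open>The sum equals \<open>y - (eig x - N (x - y)) *\<^sub>R e\<close>, which
      bounds \<open>eig y\<close> from below.\<close>
    have "(x - eig x *\<^sub>R e) + (- (x - y) + N (x - y) *\<^sub>R e) \<in> K"
      using norm_mem[of "x - y"] by (blast intro: add eig_mem)
    then have "eig x - N (x - y) \<le> eig y"
      by (intro eig_ge) (simp add: algebra_simps)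
    then show ?thesis using M(2)[of "x - y"] by linarith
  qed
  have "M-lipschitz_on S eig"
  proof (rule lipschitz_onI)
    fix x y
    show "dist (eig x) (eig y) \<le> M * dist x y"
      using one[of x y] one[of y x] by (simp add: dist_norm norm_minus_commute abs_le_iff)
  qed (use M in simp)
  then show ?thesis by (rule lipschitz_on_continuous_on)
qed

text \<open>This set is the unit ball of the dual norm, written as an intersection of half-spaces so
  that closedness is immediate. Testing \<open>w\<close> against itself bounds it.\<close>

lemma compact_dual_ball: "compact {w. \<forall>x. w \<bullet> x \<le> N x}"
proof -
  obtain M where M: "M > 0" "\<And>x. N x \<le> M * norm x"
    using cone_norm_le_norm by blast
  have "norm w \<le> M" if "\<forall>x. w \<bullet> x \<le> N x" for w
  proof -
    have "norm w * norm w \<le> M * norm w"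
      using that M(2)[of w] by (metis order_trans power2_eq_square power2_norm_eq_inner)
    then show ?thesis
      using M(1) by (cases "w = 0") auto
  qed
  then have "bounded {w. \<forall>x. w \<bullet> x \<le> N x}"
    unfolding bounded_iff by blast
  moreover have "closed {w. \<forall>x. w \<bullet> x \<le> N x}"
    by (intro closed_Collect_all closed_Collect_le continuous_intros)
  ultimately show ?thesis
    by (simp add: compact_eq_bounded_closed)
qed

lemma convex_dual_ball: "convex {w. \<forall>x. w \<bullet> x \<le> N x}"
  unfolding convex_alt
  by (auto simp: inner_add_left intro!: convex_bound_le)

lemma compact_dual_slice: "compact (dual_slice K e)"
proof -
  have "closed (\<Inter>x\<in>K. {u. 0 \<le> u \<bullet> x})"
    by (intro closed_INT ballI closed_Collect_le continuous_intros)
  moreover have "closed {u. u \<bullet> e = 1}"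
    by (intro closed_Collect_eq continuous_intros)
  moreover have "dual_slice K e = (\<Inter>x\<in>K. {u. 0 \<le> u \<bullet> x}) \<inter> {u. u \<bullet> e = 1}"
    by (auto simp: slice_eq dual_cone_def)
  ultimately have "closed (dual_slice K e)"
    by (simp add: closed_Int)
  moreover have "dual_slice K e = {w. \<forall>x. w \<bullet> x \<le> N x} \<inter> dual_slice K e"
    using dual_slice_inner_le by blast
  ultimately show ?thesis
    by (metis compact_Int_closed compact_dual_ball)
qed

lemma convex_dual_slice: "convex (dual_slice K e)"
  unfolding slice_eq dual_cone_def convex_alt
  by (auto simp: inner_add_left)

section \<open>Separation from the orthogonal complement\<close>

lemma dual_norm_le_max_eigenvalue:
  assumes L: "subspace L" and v0: "0 \<le> v"
    and v: "\<And>x. x \<in> L \<Longrightarrow> N x \<le> 1 \<Longrightarrow> eig x \<le> v"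
  obtains u y where "u \<in> dual_slice K e" "y \<in> L\<^sup>\<bottom>" "dual_norm N (u - y) \<le> v"
proof -
  \<comment> \<open>The dual ball of radius \<open>v\<close>; as a scaled image it also covers
    \<open>v = 0\<close>, where it is the origin alone.\<close>
  define W where "W = (\<lambda>w. v *\<^sub>R w) ` {w. \<forall>x. w \<bullet> x \<le> N x}"
  define S where "S = (\<Union>u\<in>dual_slice K e. \<Union>w\<in>W. {u - w})"
  have W: "compact W" "convex W"
    unfolding W_def by (intro compact_scaling convex_scaling compact_dual_ball convex_dual_ball)+
  then have "compact S" "convex S"
    unfolding S_def
    by (intro compact_differences' convex_differences compact_dual_slice convex_dual_slice W)+
  obtain u0 where u0: "u0 \<in> dual_slice K e"
    using cone_eigenvalue_eq_inner by blast
  have "v *\<^sub>R u0 \<in> W"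
    unfolding W_def using dual_slice_inner_le[OF u0] by (intro imageI) simp
  with u0 have "S \<noteq> {}" unfolding S_def by blast
  have "\<not> S \<inter> L\<^sup>\<bottom> = {}"
  proof
    assume "S \<inter> L\<^sup>\<bottom> = {}"
    then have "L\<^sup>\<bottom> \<inter> S = {}"
      by (simp add: Int_commute)
    from separating_hyperplane_closed_compact[OF subspace_imp_convex[OF subspace_orthogonal_comp]
        closed_subspace[OF subspace_orthogonal_comp] \<open>convex S\<close> \<open>compact S\<close> \<open>S \<noteq> {}\<close> this]
    obtain a b where ab: "\<And>y. y \<in> L\<^sup>\<bottom> \<Longrightarrow> a \<bullet> y < b" "\<And>s. s \<in> S \<Longrightarrow> b < a \<bullet> s"
      by metis
    have b: "0 < b"
      using ab(1)[of 0] subspace_0[OF subspace_orthogonal_comp[of L]] by simp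
    have "a \<in> (L\<^sup>\<bottom>)\<^sup>\<bottom>"
      using ab(1) by (intro subspace_bounded_above_imp_orthogonal_comp[of _ _ b]
          subspace_orthogonal_comp) (simp add: less_imp_le)
    then have aL: "a \<in> L"
      using L by (simp add: orthogonal_comp_self)
    obtain u where u: "u \<in> dual_slice K e" "a \<bullet> u = eig a"
      using cone_eigenvalue_eq_inner by blast
    obtain w where w: "\<And>x. w \<bullet> x \<le> N x" "w \<bullet> a = N a"
      using cone_norm_eq_inner by blast
    \<comment> \<open>\<open>u\<close> minimizes \<open>a\<close> over the slice and
      \<open>w\<close> norms \<open>a\<close>, so this is the point of \<open>S\<close> where
      \<open>a\<close> is smallest.\<close>
    have "u - v *\<^sub>R w \<in> S"
      using u w unfolding S_def W_def by blast
    then have gt: "b < eig a - v * N a"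
      using ab(2)[of "u - v *\<^sub>R w"] u w by (simp add: inner_diff_right inner_commute)
    have "a \<noteq> 0"
      using ab(2) \<open>S \<noteq> {}\<close> b by force
    then have pos: "N a > 0"
      using norm_mem[of a] norm_eq_0[of a] by linarith
    \<comment> \<open>Normalizing \<open>a\<close> brings it into the unit ball of \<open>L\<close>,
      where \<open>v\<close> bounds the eigenvalue.\<close>
    have "(1 / N a) *\<^sub>R (a - eig a *\<^sub>R e) \<in> K"
      using eig_mem[of a] pos by (intro scale) auto
    then have "eig a / N a \<le> eig ((1 / N a) *\<^sub>R a)"
      by (intro eig_ge) (simp add: algebra_simps)
    also have "\<dots> \<le> v"
      using aL L pos by (intro v) (auto simp: subspace_scale norm_scale)
    finally show False
      using gt b pos by (simp add: field_simps)
  qed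
  then obtain u w where u: "u \<in> dual_slice K e" and w: "\<And>x. w \<bullet> x \<le> N x"
    and y: "u - v *\<^sub>R w \<in> L\<^sup>\<bottom>"
    unfolding S_def W_def by auto
  have "dual_norm N (u - (u - v *\<^sub>R w)) \<le> v"
    using w v0 by (intro dual_norm_leI) (simp add: mult_left_mono)
  then show ?thesis using that u y by blast
qed

end

text \<open>\<open>INF\<close> and \<open>SUP\<close> alone do not assert minima and maxima; the
  attainment conjuncts supply this, for the inner extrema as well.\<close>

theorem proposition3:
  fixes K :: "'a::euclidean_space set" and e :: 'a and L :: "'a set"
  assumes "regular_cone K" and "e \<in> interior K" and "subspace L"
  shows
    "nu (cone_norm K e) K L
       = (INF u\<in>dual_slice K e. SUP x\<in>{x \<in> L. cone_norm K e x \<le> 1}. x \<bullet> u) \<and>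
     (INF u\<in>dual_slice K e. SUP x\<in>{x \<in> L. cone_norm K e x \<le> 1}. x \<bullet> u)
       = (SUP x\<in>{x \<in> L. cone_norm K e x \<le> 1}. INF u\<in>dual_slice K e. x \<bullet> u) \<and>
     (SUP x\<in>{x \<in> L. cone_norm K e x \<le> 1}. INF u\<in>dual_slice K e. x \<bullet> u)
       = (SUP x\<in>{x \<in> L. cone_norm K e x \<le> 1}. cone_eigenvalue K e x) \<and>
     attains_min (\<lambda>(u, y). dual_norm (cone_norm K e) (u - y)) (nu_domain (cone_norm K e) K L) \<and>
     attains_min (\<lambda>u. SUP x\<in>{x \<in> L. cone_norm K e x \<le> 1}. x \<bullet> u) (dual_slice K e) \<and>
     (\<forall>u\<in>dual_slice K e. attains_max (\<lambda>x. x \<bullet> u) {x \<in> L. cone_norm K e x \<le> 1}) \<and>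
     attains_max (\<lambda>x. INF u\<in>dual_slice K e. x \<bullet> u) {x \<in> L. cone_norm K e x \<le> 1} \<and>
     (\<forall>x\<in>{x \<in> L. cone_norm K e x \<le> 1}. attains_min (\<lambda>u. x \<bullet> u) (dual_slice K e)) \<and>
     attains_max (cone_eigenvalue K e) {x \<in> L. cone_norm K e x \<le> 1}"
proof -
  note K = assms(1) and e = assms(2) and L = assms(3)
  let ?N = "cone_norm K e" and ?D = "dual_slice K e" and ?eig = "cone_eigenvalue K e"
  let ?B = "{x \<in> L. ?N x \<le> 1}"
  have B0: "0 \<in> ?B"
    using L cone_norm_zero_iff[OF K e, of 0] by (simp add: subspace_0)
  have compB: "compact ?B"
    using compact_cone_norm_ball_Int_subspace[OF K e L] .
  obtain z where z: "z \<in> ?B" and zmax: "\<And>x. x \<in> ?B \<Longrightarrow> ?eig x \<le> ?eig z"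
    using continuous_attains_sup[OF compB _ continuous_on_cone_eigenvalue[OF K e]] B0 by blast
  define v where "v = ?eig z"
  have "0 \<le> ?eig 0"
    using cone_eigenvalue_attained(2)[OF K e, of 0 0] K
    by (simp add: regular_cone_def convex_cone_contains_0)
  then have v0: "0 \<le> v"
    using zmax[OF B0] by (simp add: v_def)
  \<comment> \<open>This pair closes the chain of inequalities that starts at \<open>v\<close>, and
    so witnesses both outer minima.\<close>
  obtain u y where uy: "u \<in> ?D" "y \<in> L\<^sup>\<bottom>" "dual_norm ?N (u - y) \<le> v"
    using dual_norm_le_max_eigenvalue[OF K e L v0] zmax unfolding v_def by blast

  have inner_min: "(INF u\<in>?D. x \<bullet> u) = ?eig x" and attained_min: "attains_min (\<lambda>u. x \<bullet> u) ?D" for x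
  proof -
    obtain u' where u': "u' \<in> ?D" "x \<bullet> u' = ?eig x"
      using cone_eigenvalue_eq_inner[OF K e] by blast
    show "(INF u\<in>?D. x \<bullet> u) = ?eig x"
      using u' cone_eigenvalue_le_inner[OF K e]
      by (intro cInf_eq_minimum) (auto intro: rev_image_eqI)
    show "attains_min (\<lambda>u. x \<bullet> u) ?D"
      unfolding attains_min_def using u' cone_eigenvalue_le_inner[OF K e] by metis
  qed
  have attained_max: "attains_max (\<lambda>x. x \<bullet> u') ?B" for u'
    unfolding attains_max_def
    using B0 by (intro continuous_attains_sup[OF compB] continuous_intros) auto
  have sup_ge: "x \<bullet> u' \<le> (SUP x\<in>?B. x \<bullet> u')" if "x \<in> ?B" for x u'
  proof (rule cSUP_upper[OF that])
    show "bdd_above ((\<lambda>x. x \<bullet> u') ` ?B)"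
      using attained_max[of u'] unfolding attains_max_def bdd_above_def by blast
  qed
  \<comment> \<open>Subtracting \<open>y'\<close> does not change the pairing with points of
    \<open>L\<close>.\<close>
  have sup_le: "(SUP x\<in>?B. x \<bullet> u') \<le> dual_norm ?N (u' - y')" if "y' \<in> L\<^sup>\<bottom>" for u' y'
  proof (rule cSUP_least)
    fix x assume x: "x \<in> ?B"
    have "x \<bullet> y' = 0"
      using that x by (simp add: orthogonal_comp_def orthogonal_def)
    then have "x \<bullet> u' = (u' - y') \<bullet> x"
      by (simp add: inner_commute[of _ x] inner_diff_right)
    also have "\<dots> \<le> dual_norm ?N (u' - y') * ?N x"
      by (rule inner_le_dual_norm[OF K e])
    also have "\<dots> \<le> dual_norm ?N (u' - y')"
      using x dual_norm_nonneg[OF K e] by (intro mult_left_le) auto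
    finally show "x \<bullet> u' \<le> dual_norm ?N (u' - y')" .
  qed (use B0 in blast)
  have v_le_sup: "v \<le> (SUP x\<in>?B. x \<bullet> u')" if "u' \<in> ?D" for u'
    using cone_eigenvalue_le_inner[OF K e that, of z] sup_ge[OF z, of u'] by (simp add: v_def)
  have sup_u: "(SUP x\<in>?B. x \<bullet> u) = v"
    using v_le_sup[OF uy(1)] sup_le[OF uy(2), of u] uy(3) by linarith
  have dom: "nu_domain ?N K L = ?D \<times> (L\<^sup>\<bottom>)"
    by (auto simp: nu_domain_def dual_slice_def)
  have v_le_dual: "v \<le> dual_norm ?N (u' - y')" if "u' \<in> ?D" "y' \<in> L\<^sup>\<bottom>" for u' y'
    using v_le_sup[OF that(1)] sup_le[OF that(2), of u'] by linarith
  have dual_uy: "dual_norm ?N (u - y) = v"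
    using v_le_dual[OF uy(1,2)] uy(3) by linarith

  have nu_eq: "nu ?N K L = v"
    unfolding nu_def dom
  proof (rule cInf_eq_minimum)
    show "v \<in> (\<lambda>(u, y). dual_norm ?N (u - y)) ` (?D \<times> (L\<^sup>\<bottom>))"
      using uy(1,2) dual_uy by (intro image_eqI[of _ _ "(u, y)"]) auto
    show "v \<le> r" if "r \<in> (\<lambda>(u, y). dual_norm ?N (u - y)) ` (?D \<times> (L\<^sup>\<bottom>))" for r
      using that v_le_dual by fast
  qed
  have minmax_eq: "(INF u\<in>?D. SUP x\<in>?B. x \<bullet> u) = v"
  proof (rule cInf_eq_minimum)
    show "v \<in> (\<lambda>u. SUP x\<in>?B. x \<bullet> u) ` ?D"
      using uy(1) by (intro image_eqI[of _ _ u] sup_u[symmetric])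
    show "v \<le> r" if "r \<in> (\<lambda>u. SUP x\<in>?B. x \<bullet> u) ` ?D" for r
      using that v_le_sup by fast
  qed
  have max_eig_eq: "(SUP x\<in>?B. ?eig x) = v"
  proof (rule cSup_eq_maximum)
    show "v \<in> ?eig ` ?B"
      unfolding v_def using z by (rule imageI)
    show "r \<le> v" if "r \<in> ?eig ` ?B" for r
      unfolding v_def using that zmax by fast
  qed
  have nu_attained: "attains_min (\<lambda>(u, y). dual_norm ?N (u - y)) (nu_domain ?N K L)"
    unfolding attains_min_def dom
  proof (rule bexI[of _ "(u, y)"])
    show "\<forall>p\<in>?D \<times> (L\<^sup>\<bottom>). (case (u, y) of (u, y) \<Rightarrow> dual_norm ?N (u - y))
        \<le> (case p of (u, y) \<Rightarrow> dual_norm ?N (u - y))"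
      using v_le_dual by (auto simp only: prod.case dual_uy)
  qed (use uy in blast)
  have minmax_attained: "attains_min (\<lambda>u. SUP x\<in>?B. x \<bullet> u) ?D"
    unfolding attains_min_def
  proof (rule bexI[OF ballI uy(1)])
    show "(SUP x\<in>?B. x \<bullet> u) \<le> (SUP x\<in>?B. x \<bullet> u')" if "u' \<in> ?D" for u'
      unfolding sup_u using that by (rule v_le_sup)
  qed
  have eig_attained: "attains_max ?eig ?B"
    unfolding attains_max_def using z zmax by blast
  \<comment> \<open>Rewriting with \<open>inner_min\<close> turns the max-min into the maximum of
    the eigenvalue, both in value and in attainment.\<close>
  show ?thesis
    unfolding inner_min nu_eq minmax_eq max_eig_eq
    by (intro conjI ballI refl nu_attained minmax_attained eig_attained attained_max attained_min)
qed

end
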